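(* Let $(X,\mathcal{B},\mu)$ be a standard Lebesgue probability space and let $T\in G=\mathrm{Aut}(X,\mathcal{B},\mu)$. The following are equivalent: (1) $T$ is rigid, and for every $\epsilon>0$ and all $E,F\in\mathcal{B}$ with $\mu(E),\mu(F)>0$ there exists an integer $n$ such that $T^n\in U_\epsilon$ and $\mu(T^nE\cap F)>0$. (2) $T$ is rigid and ergodic, and for every $\epsilon>0$, every $l\in\mathbb{N}$ and every $E\in\mathcal{B}$ with $\mu(E)>0$ there exists $n\in\mathbb{N}$ such that $T^n\in U_\epsilon$ and $\mu(T^nE\cap T^lE)>0$. (3) $T$ is rigid and ergodic, and for every $\epsilon>0$, every integer $l$ with $-l\in\mathbb{N}$ and every $E\in\mathcal{B}$ with $\mu(E)>0$ there exists $n\in\mathbb{N}$ such that $T^n\in U_\epsilon$ and $\mu(T^nE\cap T^lE)>0$.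
   Context: $\mathbb{N}$ denotes the positive integers. $G=\mathrm{Aut}(X,\mathcal{B},\mu)$ is the group of invertible measure-preserving transformations of $(X,\mathcal{B},\mu)$ (modulo null sets) with the weak topology, generated by the metric $d(S,T)=\sum_{n\ge1}2^{-n}\mu(SE_n\,\triangle\,TE_n)$, where $(E_n)$ is a fixed countable family of measurable sets generating $\mathcal{B}$. For $\epsilon>0$, $U_\epsilon=\{S\in G:d(S,\mathrm{Id})<\epsilon\}$. $T$ is rigid if $T^{n_k}\to\mathrm{Id}$ weakly for some sequence $n_k\to\infty$. (Condition (1) is the usual definition of a whirly automorphism; conditions (2), (3) are the two versions of the alternative definition.) *)

theory Defs
  imports "HOL-Probability.Probability" "HOL-Algebra.Coset" "HOL-Algebra.Bij"
begin

section \<open>Standard Lebesgue probability spaces\<close>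

definition iso_mod0 :: "'a measure \<Rightarrow> 'b measure \<Rightarrow> bool" where
  "iso_mod0 M N \<longleftrightarrow> (\<exists>A\<in>null_sets M. \<exists>B\<in>null_sets N. \<exists>f g.
     f \<in> restrict_space M (space M - A) \<rightarrow>\<^sub>M restrict_space N (space N - B) \<and>
     g \<in> restrict_space N (space N - B) \<rightarrow>\<^sub>M restrict_space M (space M - A) \<and>
     (\<forall>x\<in>space M - A. g (f x) = x) \<and>
     (\<forall>y\<in>space N - B. f (g y) = y) \<and>
     distr (restrict_space M (space M - A)) (restrict_space N (space N - B)) f
       = restrict_space N (space N - B))"

text \<open>
  Every standard Borel space is isomorphic to a Borel subset of the real line, so the first disjunct
  is the convention that the sigma-algebra is the Borel one, and the second the convention that it
  is completed. Atoms are allowed, as in Rokhlin's definition; in the atomless case the measure on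
  the line may be taken to be Lebesgue measure on the unit interval.
\<close>

definition standard_lebesgue_space :: "'a measure \<Rightarrow> bool" where
  "standard_lebesgue_space M \<longleftrightarrow> prob_space M \<and>
     (\<exists>\<nu> :: real measure. prob_space \<nu> \<and> sets \<nu> = sets borel \<and>
        (iso_mod0 M \<nu> \<or> iso_mod0 M (completion \<nu>)))"

text \<open>
  Generation is understood up to null sets: a complete sigma-algebra need not be the literal
  sigma-algebra generated by any countable family.
\<close>

definition generating_family :: "'a measure \<Rightarrow> (nat \<Rightarrow> 'a set) \<Rightarrow> bool" where
  "generating_family M E \<longleftrightarrow> range E \<subseteq> sets M \<and>
     (\<forall>A\<in>sets M. \<exists>A'\<in>sigma_sets (space M) (range E). sym_diff A A' \<in> null_sets M)"


section \<open>The automorphism group\<close>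

text \<open>
  Transformations are bijections of the space (extensional, as in \<open>Bij\<close>). The group of automorphisms
  is the quotient by those that are almost everywhere the identity, so its elements are the classes
  of transformations modulo equality almost everywhere.
\<close>

definition mpt :: "'a measure \<Rightarrow> ('a \<Rightarrow> 'a) set" where
  "mpt M = {T \<in> Bij (space M). T \<in> M \<rightarrow>\<^sub>M M \<and> inv_into (space M) T \<in> M \<rightarrow>\<^sub>M M \<and> distr M M T = M}"

definition mpt_group :: "'a measure \<Rightarrow> ('a \<Rightarrow> 'a) monoid" where
  "mpt_group M = (BijGroup (space M))\<lparr>carrier := mpt M\<rparr>"

definition null_mpt :: "'a measure \<Rightarrow> ('a \<Rightarrow> 'a) set" where
  "null_mpt M = {T \<in> mpt M. AE x in M. T x = x}"

definition Aut :: "'a measure \<Rightarrow> ('a \<Rightarrow> 'a) set monoid" where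
  "Aut M = mpt_group M Mod null_mpt M"

text \<open>
  The image of a set under an automorphism is defined up to a null set; the lemmas
  \<open>act_coset\<close> and \<open>act_representative\<close> below show that the choice of representative
  is irrelevant.
\<close>

definition act :: "('a \<Rightarrow> 'a) set \<Rightarrow> 'a set \<Rightarrow> 'a set" where
  "act \<tau> A = (SOME T. T \<in> \<tau>) ` A"

lemma mpt_D:
  assumes "T \<in> mpt M"
  shows mpt_Bij: "T \<in> Bij (space M)"
    and mpt_bij_betw: "bij_betw T (space M) (space M)"
    and mpt_measurable: "T \<in> M \<rightarrow>\<^sub>M M"
    and mpt_inv_measurable: "inv_into (space M) T \<in> M \<rightarrow>\<^sub>M M"
    and mpt_distr: "distr M M T = M"
  using assms by (auto simp: mpt_def Bij_def)

lemma mpt_AE: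
  assumes T: "T \<in> mpt M" and P: "AE x in M. P x"
  shows "AE x in M. P (T x)"
proof (rule AE_distrD[OF mpt_measurable[OF T]])
  show "AE x in distr M M T. P x" using P unfolding mpt_distr[OF T] .
qed

lemma mpt_image_eq_vimage:
  assumes "T \<in> mpt M" "A \<subseteq> space M"
  shows "T ` A = inv_into (space M) T -` A \<inter> space M"
proof -
  have b: "bij_betw T (space M) (space M)" using assms(1) by (rule mpt_bij_betw)
  show ?thesis
    using assms(2) b bij_betw_inv_into_left[OF b] bij_betw_inv_into_right[OF b]
    by (fastforce simp: bij_betw_def image_iff)
qed

lemma mpt_image_sets:
  assumes "T \<in> mpt M" "A \<in> sets M"
  shows "T ` A \<in> sets M"
  using mpt_image_eq_vimage[OF assms(1) sets.sets_into_space[OF assms(2)]]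
    measurable_sets[OF mpt_inv_measurable[OF assms(1)] assms(2)] by simp

lemma mpt_inv:
  assumes "T \<in> mpt M"
  shows "(\<lambda>x\<in>space M. inv_into (space M) T x) \<in> mpt M"
proof -
  let ?S = "\<lambda>x\<in>space M. inv_into (space M) T x"
  have b: "bij_betw T (space M) (space M)" using assms by (rule mpt_bij_betw)
  have 1: "?S \<in> Bij (space M)"
    using assms by (intro restrict_inv_into_Bij mpt_Bij)
  have 2: "?S \<in> M \<rightarrow>\<^sub>M M"
    using mpt_inv_measurable[OF assms] by (subst measurable_cong[of _ _ "inv_into (space M) T"]) auto
  have bS: "bij_betw ?S (space M) (space M)" using 1 by (simp add: Bij_def)
  have inv: "inv_into (space M) ?S x = T x" if "x \<in> space M" for x
  proof (rule inv_into_f_eq)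
    show "inj_on ?S (space M)" using bS by (simp add: bij_betw_def)
    show "T x \<in> space M" using b that by (auto simp: bij_betw_def)
    then show "?S (T x) = x" using b that by (simp add: bij_betw_inv_into_left)
  qed
  have 3: "inv_into (space M) ?S \<in> M \<rightarrow>\<^sub>M M"
    using mpt_measurable[OF assms] inv by (subst measurable_cong[of _ _ T]) auto
  have "distr M M ?S = distr (distr M M T) M ?S"
    using mpt_distr[OF assms] by simp
  also have "\<dots> = distr M M (?S \<circ> T)"
    by (rule distr_distr[OF 2 mpt_measurable[OF assms]])
  also have "\<dots> = distr M M (\<lambda>x. x)"
    using b measurable_space[OF mpt_measurable[OF assms]]
    by (intro distr_cong) (auto simp: bij_betw_inv_into_left)
  finally have 4: "distr M M ?S = M" by (simp add: distr_id2)
  show ?thesis using 1 2 3 4 by (simp add: mpt_def)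
qed

lemma mpt_compose:
  assumes "S \<in> mpt M" "T \<in> mpt M"
  shows "compose (space M) S T \<in> mpt M"
proof -
  have bS: "bij_betw S (space M) (space M)" and bT: "bij_betw T (space M) (space M)"
    using assms by (auto intro: mpt_bij_betw)
  note mS = mpt_measurable[OF assms(1)] and mT = mpt_measurable[OF assms(2)]
  have 1: "compose (space M) S T \<in> Bij (space M)"
    using assms by (intro compose_Bij mpt_Bij)
  have "S \<circ> T \<in> M \<rightarrow>\<^sub>M M" using mS mT by (rule measurable_comp[rotated])
  then have 2: "compose (space M) S T \<in> M \<rightarrow>\<^sub>M M"
    by (subst measurable_cong[of _ _ "S \<circ> T"]) (auto simp: compose_def)
  have inv: "inv_into (space M) (compose (space M) S T) x
      = inv_into (space M) T (inv_into (space M) S x)" if "x \<in> space M" for x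
  proof (rule inv_into_f_eq)
    show "inj_on (compose (space M) S T) (space M)" using 1 by (simp add: Bij_def bij_betw_def)
    have i: "inv_into (space M) S x \<in> space M"
      using bS that by (metis bij_betw_def inv_into_into)
    then show j: "inv_into (space M) T (inv_into (space M) S x) \<in> space M"
      using bT by (metis bij_betw_def inv_into_into)
    show "compose (space M) S T (inv_into (space M) T (inv_into (space M) S x)) = x"
      using i j bS bT that by (simp add: compose_def bij_betw_inv_into_right)
  qed
  have "inv_into (space M) T \<circ> inv_into (space M) S \<in> M \<rightarrow>\<^sub>M M"
    using mpt_inv_measurable[OF assms(1)] mpt_inv_measurable[OF assms(2)] by (rule measurable_comp)
  then have 3: "inv_into (space M) (compose (space M) S T) \<in> M \<rightarrow>\<^sub>M M"
    using inv by (subst measurable_cong[of _ _ "inv_into (space M) T \<circ> inv_into (space M) S"]) auto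
  have "distr M M (compose (space M) S T) = distr M M (S \<circ> T)"
    by (intro distr_cong) (auto simp: compose_def)
  also have "\<dots> = distr (distr M M T) M S"
    by (rule distr_distr[OF mS mT, symmetric])
  also have "\<dots> = M" using assms by (simp add: mpt_distr)
  finally show ?thesis using 1 2 3 by (simp add: mpt_def)
qed

lemma carrier_mpt_group: "carrier (mpt_group M) = mpt M"
  by (simp add: mpt_group_def)

lemma mult_mpt_group:
  "S \<in> mpt M \<Longrightarrow> T \<in> mpt M \<Longrightarrow> S \<otimes>\<^bsub>mpt_group M\<^esub> T = compose (space M) S T"
  by (simp add: mpt_group_def BijGroup_def mpt_Bij)

lemma one_mpt_group: "\<one>\<^bsub>mpt_group M\<^esub> = (\<lambda>x\<in>space M. x)"
  by (simp add: mpt_group_def BijGroup_def)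

lemma id_mpt: "(\<lambda>x\<in>space M. x) \<in> mpt M"
proof -
  have i: "inv_into (space M) (\<lambda>x\<in>space M. x) x = x" if "x \<in> space M" for x
    using that by (intro inv_into_f_eq) (auto simp: inj_on_def)
  have "distr M M (\<lambda>x\<in>space M. x) = distr M M (\<lambda>x. x)"
    by (intro distr_cong) auto
  moreover have "(\<lambda>x\<in>space M. x) \<in> M \<rightarrow>\<^sub>M M"
    by (subst measurable_cong[of _ _ "\<lambda>x. x"]) auto
  moreover have "inv_into (space M) (\<lambda>x\<in>space M. x) \<in> M \<rightarrow>\<^sub>M M"
    using i by (subst measurable_cong[of _ _ "\<lambda>x. x"]) auto
  ultimately show ?thesis by (simp add: mpt_def id_Bij distr_id2)
qed

lemma group_mpt_group: "group (mpt_group M)"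
proof (rule groupI)
  fix T assume T: "T \<in> carrier (mpt_group M)"
  then have T': "T \<in> mpt M" by (simp add: carrier_mpt_group)
  show "\<one>\<^bsub>mpt_group M\<^esub> \<otimes>\<^bsub>mpt_group M\<^esub> T = T"
    using T' id_mpt[of M] mpt_Bij[OF T']
    by (simp add: mult_mpt_group one_mpt_group Bij_imp_funcset Bij_imp_extensional)
  show "\<exists>S\<in>carrier (mpt_group M). S \<otimes>\<^bsub>mpt_group M\<^esub> T = \<one>\<^bsub>mpt_group M\<^esub>"
    using T' mpt_inv[OF T'] Bij_compose_restrict_eq[OF mpt_Bij[OF T']]
    by (intro bexI[of _ "\<lambda>x\<in>space M. inv_into (space M) T x"])
      (auto simp: mult_mpt_group one_mpt_group carrier_mpt_group)
qed (auto simp: carrier_mpt_group mult_mpt_group one_mpt_group mpt_compose id_mpt mpt_Bij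
       Bij_imp_funcset compose_assoc[symmetric])

lemma inv_mpt_group:
  assumes "T \<in> mpt M"
  shows "inv\<^bsub>mpt_group M\<^esub> T = (\<lambda>x\<in>space M. inv_into (space M) T x)"
proof (rule group.inv_equality[OF group_mpt_group])
  show "(\<lambda>x\<in>space M. inv_into (space M) T x) \<otimes>\<^bsub>mpt_group M\<^esub> T = \<one>\<^bsub>mpt_group M\<^esub>"
    using assms mpt_inv[OF assms] Bij_compose_restrict_eq[OF mpt_Bij[OF assms]]
    by (auto simp: mult_mpt_group one_mpt_group)
qed (use assms mpt_inv[OF assms] in \<open>auto simp: carrier_mpt_group\<close>)

lemma normal_null_mpt: "null_mpt M \<lhd> mpt_group M"
proof -
  interpret group "mpt_group M" by (rule group_mpt_group)
  have sub: "subgroup (null_mpt M) (mpt_group M)"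
  proof
    show "null_mpt M \<subseteq> carrier (mpt_group M)"
      by (auto simp: null_mpt_def carrier_mpt_group)
    show "\<one>\<^bsub>mpt_group M\<^esub> \<in> null_mpt M"
      by (simp add: null_mpt_def one_mpt_group id_mpt)
    fix S assume S: "S \<in> null_mpt M"
    then have S': "S \<in> mpt M" "AE x in M. S x = x" by (auto simp: null_mpt_def)
    have "AE x in M. inv_into (space M) S x = x"
      using S'(2) AE_space
      by eventually_elim (metis S'(1) bij_betw_inv_into_left mpt_bij_betw)
    then have "AE x in M. (\<lambda>x\<in>space M. inv_into (space M) S x) x = x"
      using AE_space by eventually_elim auto
    then show "inv\<^bsub>mpt_group M\<^esub> S \<in> null_mpt M"
      using S' mpt_inv by (simp add: inv_mpt_group null_mpt_def)
    fix T assume "T \<in> null_mpt M"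
    then have T': "T \<in> mpt M" "AE x in M. T x = x" by (auto simp: null_mpt_def)
    have "AE x in M. compose (space M) S T x = x"
      using S'(2) T'(2) AE_space by eventually_elim (auto simp: compose_def)
    then show "S \<otimes>\<^bsub>mpt_group M\<^esub> T \<in> null_mpt M"
      using S' T' by (simp add: mult_mpt_group null_mpt_def mpt_compose)
  qed
  show ?thesis unfolding normal_inv_iff
  proof (intro conjI sub ballI)
    fix T S assume "T \<in> carrier (mpt_group M)" and S: "S \<in> null_mpt M"
    then have T: "T \<in> mpt M" by (simp add: carrier_mpt_group)
    have S': "S \<in> mpt M" "AE x in M. S x = x" using S by (auto simp: null_mpt_def)
    let ?R = "\<lambda>x\<in>space M. inv_into (space M) T x"
    have R: "?R \<in> mpt M" using T by (rule mpt_inv)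
    have "AE x in M. S (?R x) = ?R x" using R S'(2) by (rule mpt_AE)
    then have "AE x in M. compose (space M) (compose (space M) T S) ?R x = x"
      using AE_space
    proof eventually_elim
      case (elim x)
      then show ?case
        using bij_betw_inv_into_right[OF mpt_bij_betw[OF T]] inv_into_into[of x T "space M"]
          mpt_bij_betw[OF T]
        by (auto simp: compose_def bij_betw_def)
    qed
    then show "T \<otimes>\<^bsub>mpt_group M\<^esub> S \<otimes>\<^bsub>mpt_group M\<^esub> inv\<^bsub>mpt_group M\<^esub> T \<in> null_mpt M"
      using T S' R by (simp add: inv_mpt_group mult_mpt_group mpt_compose null_mpt_def)
  qed
qed

lemma group_Aut: "group (Aut M)"
  unfolding Aut_def by (rule normal.factorgroup_is_group[OF normal_null_mpt])

lemma coset_AE_eq: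
  assumes T: "T \<in> mpt M" and S: "S \<in> null_mpt M #>\<^bsub>mpt_group M\<^esub> T"
  shows "S \<in> mpt M \<and> (AE x in M. S x = T x)"
proof -
  from S obtain N where N: "N \<in> null_mpt M" and "S = N \<otimes>\<^bsub>mpt_group M\<^esub> T"
    by (auto simp: r_coset_def)
  then have S: "S = compose (space M) N T" and N': "N \<in> mpt M"
    using T by (auto simp: mult_mpt_group null_mpt_def)
  have "AE x in M. N x = x" using N by (simp add: null_mpt_def)
  with T have "AE x in M. N (T x) = T x" by (rule mpt_AE)
  then have "AE x in M. S x = T x" using AE_space
    by eventually_elim (simp add: S compose_def)
  then show ?thesis using N' T by (simp add: S mpt_compose)
qed

lemma mpt_image_AE_cong:
  assumes S: "S \<in> mpt M" and T: "T \<in> mpt M" and A: "A \<in> sets M" and eq: "AE x in M. S x = T x"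
  shows "sym_diff (S ` A) (T ` A) \<in> null_sets M"
proof -
  let ?R = "\<lambda>x\<in>space M. inv_into (space M) S x"
  have "AE x in M. S (?R x) = T (?R x)" using mpt_inv[OF S] eq by (rule mpt_AE)
  then have "AE x in M. x \<in> S ` A \<longleftrightarrow> x \<in> T ` A" using AE_space
  proof eventually_elim
    case (elim x)
    have bS: "bij_betw S (space M) (space M)" and bT: "bij_betw T (space M) (space M)"
      using S T by (auto intro: mpt_bij_betw)
    let ?y = "inv_into (space M) S x"
    have y: "?y \<in> space M" using bS elim(2) by (metis bij_betw_def inv_into_into)
    have Sx: "S ?y = x" using bS elim(2) by (simp add: bij_betw_inv_into_right)
    have Tx: "T ?y = x" using elim Sx by simp
    have "inv_into (space M) T x = ?y"
      using bij_betw_inv_into_left[OF bT y] Tx by simp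
    then show ?case
      using elim(2) sets.sets_into_space[OF A]
      by (simp add: mpt_image_eq_vimage[OF S] mpt_image_eq_vimage[OF T])
  qed
  then have "AE x in M. x \<notin> sym_diff (S ` A) (T ` A)" by eventually_elim auto
  moreover have "sym_diff (S ` A) (T ` A) \<in> sets M"
    using S T A by (intro sets.Un sets.Diff mpt_image_sets)
  ultimately show ?thesis by (simp add: AE_iff_null_sets)
qed

lemma act_coset:
  assumes T: "T \<in> mpt M" and A: "A \<in> sets M"
  shows "act (null_mpt M #>\<^bsub>mpt_group M\<^esub> T) A \<in> sets M"
    and "sym_diff (act (null_mpt M #>\<^bsub>mpt_group M\<^esub> T) A) (T ` A) \<in> null_sets M"
proof -
  interpret normal "null_mpt M" "mpt_group M" by (rule normal_null_mpt)
  have "T \<in> null_mpt M #>\<^bsub>mpt_group M\<^esub> T"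
    using T by (intro rcos_self subgroup_axioms) (simp add: carrier_mpt_group)
  then have "(SOME S. S \<in> null_mpt M #>\<^bsub>mpt_group M\<^esub> T) \<in> null_mpt M #>\<^bsub>mpt_group M\<^esub> T"
    by (rule someI[where P = "\<lambda>S. S \<in> null_mpt M #>\<^bsub>mpt_group M\<^esub> T"])
  from coset_AE_eq[OF T this]
  show "act (null_mpt M #>\<^bsub>mpt_group M\<^esub> T) A \<in> sets M"
    and "sym_diff (act (null_mpt M #>\<^bsub>mpt_group M\<^esub> T) A) (T ` A) \<in> null_sets M"
    unfolding act_def using T A by (auto intro: mpt_image_sets mpt_image_AE_cong)
qed

lemma act_representative:
  assumes "\<tau> \<in> carrier (Aut M)" and "T \<in> \<tau>" and A: "A \<in> sets M"
  shows "act \<tau> A \<in> sets M" and "sym_diff (act \<tau> A) (T ` A) \<in> null_sets M"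
proof -
  interpret normal "null_mpt M" "mpt_group M" by (rule normal_null_mpt)
  obtain T0 where T0: "T0 \<in> mpt M" and \<tau>: "\<tau> = null_mpt M #>\<^bsub>mpt_group M\<^esub> T0"
    using assms(1) by (auto simp: Aut_def carrier_FactGroup carrier_mpt_group)
  have T: "T \<in> mpt M" using coset_AE_eq[OF T0] assms(2) \<tau> by blast
  have "\<tau> = null_mpt M #>\<^bsub>mpt_group M\<^esub> T"
    using assms(2) T0 unfolding \<tau>
    by (intro repr_independence subgroup_axioms) (auto simp: carrier_mpt_group)
  then show "act \<tau> A \<in> sets M" and "sym_diff (act \<tau> A) (T ` A) \<in> null_sets M"
    using act_coset[OF T A] by simp_all
qed


section \<open>The weak topology, rigidity and ergodicity\<close>

text \<open>The family \<open>E\<close> is indexed from 0, hence the weight \<open>(1/2) ^ (n + 1)\<close> of \<open>E n\<close>.\<close>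

definition wdist :: "'a measure \<Rightarrow> (nat \<Rightarrow> 'a set) \<Rightarrow> ('a \<Rightarrow> 'a) set \<Rightarrow> ('a \<Rightarrow> 'a) set \<Rightarrow> real" where
  "wdist M E \<sigma> \<tau> = (\<Sum>n. (1/2) ^ Suc n * measure M (sym_diff (act \<sigma> (E n)) (act \<tau> (E n))))"

definition id_nhd :: "'a measure \<Rightarrow> (nat \<Rightarrow> 'a set) \<Rightarrow> real \<Rightarrow> ('a \<Rightarrow> 'a) set set" where
  "id_nhd M E \<epsilon> = {\<sigma> \<in> carrier (Aut M). wdist M E \<sigma> \<one>\<^bsub>Aut M\<^esub> < \<epsilon>}"

definition rigid :: "'a measure \<Rightarrow> (nat \<Rightarrow> 'a set) \<Rightarrow> ('a \<Rightarrow> 'a) set \<Rightarrow> bool" where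
  "rigid M E \<tau> \<longleftrightarrow> (\<exists>k :: nat \<Rightarrow> nat. filterlim k at_top sequentially \<and>
     (\<lambda>i. wdist M E (\<tau> [^]\<^bsub>Aut M\<^esub> k i) \<one>\<^bsub>Aut M\<^esub>) \<longlonglongrightarrow> 0)"

definition ergodic :: "'a measure \<Rightarrow> ('a \<Rightarrow> 'a) set \<Rightarrow> bool" where
  "ergodic M \<tau> \<longleftrightarrow> (\<forall>A\<in>sets M. sym_diff (act \<tau> A) A \<in> null_sets M \<longrightarrow>
     measure M A = 0 \<or> measure M A = 1)"


section \<open>Whirly automorphisms\<close>

definition whirly :: "'a measure \<Rightarrow> (nat \<Rightarrow> 'a set) \<Rightarrow> ('a \<Rightarrow> 'a) set \<Rightarrow> bool" where
  "whirly M E \<tau> \<longleftrightarrow> rigid M E \<tau> \<and>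
     (\<forall>\<epsilon>>0. \<forall>A\<in>sets M. \<forall>B\<in>sets M. measure M A > 0 \<longrightarrow> measure M B > 0 \<longrightarrow>
        (\<exists>n :: int. \<tau> [^]\<^bsub>Aut M\<^esub> n \<in> id_nhd M E \<epsilon> \<and>
           measure M (act (\<tau> [^]\<^bsub>Aut M\<^esub> n) A \<inter> B) > 0))"

text \<open>The set \<open>L\<close> is the range of the exponent \<open>l\<close>.\<close>

definition alt_whirly ::
  "int set \<Rightarrow> 'a measure \<Rightarrow> (nat \<Rightarrow> 'a set) \<Rightarrow> ('a \<Rightarrow> 'a) set \<Rightarrow> bool" where
  "alt_whirly L M E \<tau> \<longleftrightarrow> rigid M E \<tau> \<and> ergodic M \<tau> \<and>
     (\<forall>\<epsilon>>0. \<forall>l\<in>L. \<forall>A\<in>sets M. measure M A > 0 \<longrightarrow>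
        (\<exists>n :: int. n > 0 \<and> \<tau> [^]\<^bsub>Aut M\<^esub> n \<in> id_nhd M E \<epsilon> \<and>
           measure M (act (\<tau> [^]\<^bsub>Aut M\<^esub> n) A \<inter> act (\<tau> [^]\<^bsub>Aut M\<^esub> l) A) > 0))"

end

theory Submission
  imports Defs
begin

text \<open>
  Let \<open>A\<close> and \<open>B\<close> have positive measure. By ergodicity some \<open>T\<^sup>l\<close> with \<open>l\<close> of the prescribed
  sign moves a non-null part \<open>C\<close> of \<open>A\<close> into \<open>B\<close>, and the alternative condition for \<open>C\<close> and \<open>l\<close> gives a return time that is good for \<open>A\<close>
  and \<open>B\<close>. Conversely the whirly condition for \<open>A\<close> and \<open>T\<^sup>l A\<close> gives a time \<open>n\<close>, possibly not
  positive; since the weak metric is left invariant, adding a large rigidity time to \<open>n\<close> makes it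
  positive and changes neither the neighbourhood nor the positivity of the intersection. An
  invariant set is moved off itself by no power, so whirly automorphisms are ergodic.
\<close>

section \<open>The pseudometric of symmetric differences on events\<close>

context prob_space
begin

text \<open>Automorphisms are classes modulo null sets, so equations between images hold only up to
  null sets. They are recorded as \<open>sdist\<close> being 0, which lets such equations and
  genuine estimates be chained by one triangle inequality.\<close>

abbreviation sdist :: "'a set \<Rightarrow> 'a set \<Rightarrow> real" where
  "sdist A B \<equiv> prob (sym_diff A B)"

lemma sdist_triangle:
  assumes "A \<in> events" "B \<in> events" "C \<in> events"
  shows "sdist A C \<le> sdist A B + sdist B C"
proof -
  have "sdist A C \<le> prob (sym_diff A B \<union> sym_diff B C)"
    using assms by (intro finite_measure_mono) auto
  also have "\<dots> \<le> sdist A B + sdist B C"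
    using assms by (intro measure_Un_le) auto
  finally show ?thesis .
qed

lemma sdist_commute: "sdist A B = sdist B A"
  by (simp add: Un_commute)

text \<open>Every point of A outside A' lies in the symmetric difference. The bound serves to keep
  an intersection non-null when one of its sets is replaced by a nearby one.\<close>

lemma prob_Int_le_sdist:
  assumes "A \<in> events" "A' \<in> events" "B \<in> events"
  shows "prob (A \<inter> B) \<le> prob (A' \<inter> B) + sdist A A'"
proof -
  have "prob (A \<inter> B) \<le> prob ((A' \<inter> B) \<union> sym_diff A A')"
    using assms by (intro finite_measure_mono) auto
  also have "\<dots> \<le> prob (A' \<inter> B) + sdist A A'"
    using assms by (intro measure_Un_le) auto
  finally show ?thesis .
qed

lemma null_sets_iff_prob: "A \<in> events \<Longrightarrow> A \<in> null_sets M \<longleftrightarrow> prob A = 0"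
  by (auto simp: emeasure_eq_measure)

text \<open>In a finite measure space, a set contained in another of the same measure up to a null
  set fills it up to a null set. Applied to a set and its image, this turns forward invariance into
  invariance.\<close>

lemma sdist_zero_of_subset:
  assumes "A \<in> events" "B \<in> events" "prob (A - B) = 0" "prob A = prob B"
  shows "sdist A B = 0"
proof -
  have "prob (A \<inter> B) = prob A" "prob (B - A) = prob B - prob (A \<inter> B)"
    using assms finite_measure_Diff'[of A B] finite_measure_Diff'[of B A]
    by (auto simp: Int_commute)
  then have "prob (B - A) = 0" using assms by simp
  then show ?thesis
    using measure_Un_le[of "A - B" M "B - A"] assms measure_nonneg[of M "sym_diff A B"]
    by auto
qed

section \<open>The action of automorphism classes on events\<close>

lemma act_rep:
  assumes "\<sigma> \<in> carrier (Aut M)"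
  obtains R where "R \<in> \<sigma>" "R \<in> mpt M" "act \<sigma> = image R"
proof -
  interpret normal "null_mpt M" "mpt_group M" by (rule normal_null_mpt)
  obtain T where T: "T \<in> mpt M" and \<sigma>: "\<sigma> = null_mpt M #>\<^bsub>mpt_group M\<^esub> T"
    using assms by (auto simp: Aut_def carrier_FactGroup carrier_mpt_group)
  have "T \<in> \<sigma>"
    unfolding \<sigma> using T by (intro rcos_self subgroup_axioms) (simp add: carrier_mpt_group)
  then have R: "(SOME S. S \<in> \<sigma>) \<in> \<sigma>"
    by (rule someI[where P = "\<lambda>S. S \<in> \<sigma>"])
  then have "(SOME S. S \<in> \<sigma>) \<in> mpt M" using coset_AE_eq[OF T] \<sigma> by blast
  then show ?thesis using R by (intro that) (auto simp: act_def)
qed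

lemma act_sets: "\<sigma> \<in> carrier (Aut M) \<Longrightarrow> A \<in> events \<Longrightarrow> act \<sigma> A \<in> events"
  by (metis act_rep mpt_image_sets)

lemma act_Un: "act \<sigma> (A \<union> B) = act \<sigma> A \<union> act \<sigma> B"
  by (auto simp: act_def)

lemma act_UN: "act \<sigma> (\<Union>i\<in>I. A i) = (\<Union>i\<in>I. act \<sigma> (A i))"
  by (auto simp: act_def)

lemma act_mono: "A \<subseteq> B \<Longrightarrow> act \<sigma> A \<subseteq> act \<sigma> B"
  by (auto simp: act_def)

text \<open>On all sets \<open>act \<sigma>\<close> uses the same representative, a true bijection
  of the space. Boolean operations are therefore respected exactly, not only up to null
  sets.\<close>

lemma act_Diff:
  assumes "\<sigma> \<in> carrier (Aut M)" "A \<in> events" "B \<in> events"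
  shows "act \<sigma> (A - B) = act \<sigma> A - act \<sigma> B"
proof -
  obtain R where R: "R \<in> mpt M" "act \<sigma> = image R" using act_rep[OF assms(1)] .
  have "inj_on R (space M)" using mpt_bij_betw[OF R(1)] by (simp add: bij_betw_def)
  then show ?thesis
    using assms(2,3)[THEN sets.sets_into_space] unfolding R(2)
    by (intro inj_on_image_set_diff) auto
qed

lemma act_space: "\<sigma> \<in> carrier (Aut M) \<Longrightarrow> act \<sigma> (space M) = space M"
  by (metis act_rep bij_betw_def mpt_bij_betw)

lemma act_Int:
  assumes "\<sigma> \<in> carrier (Aut M)" "A \<in> events" "B \<in> events"
  shows "act \<sigma> (A \<inter> B) = act \<sigma> A \<inter> act \<sigma> B"
proof -
  have "A \<inter> B = A - (A - B)" by auto
  then show ?thesis using assms by (auto simp: act_Diff)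
qed

lemma prob_act:
  assumes "\<sigma> \<in> carrier (Aut M)" "A \<in> events"
  shows "prob (act \<sigma> A) = prob A"
proof -
  obtain R where R: "R \<in> mpt M" "act \<sigma> = image R" using act_rep[OF assms(1)] .
  have RA: "R ` A \<in> events" using R assms by (simp add: mpt_image_sets)
  have "R -` (R ` A) \<inter> space M = A"
    using mpt_bij_betw[OF R(1)] sets.sets_into_space[OF assms(2)]
    by (auto simp: bij_betw_def dest: inj_onD)
  then show ?thesis
    using measure_distr[OF mpt_measurable[OF R(1)] RA] mpt_distr[OF R(1)] R(2) by simp
qed

lemma sdist_act:
  assumes "\<sigma> \<in> carrier (Aut M)" "A \<in> events" "B \<in> events"
  shows "sdist (act \<sigma> A) (act \<sigma> B) = sdist A B"
  using prob_act[of \<sigma> "sym_diff A B"] assms by (simp add: act_Un act_Diff)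

section \<open>Products and powers acting up to null sets\<close>

lemma one_Aut: "\<one>\<^bsub>Aut M\<^esub> \<in> carrier (Aut M)"
  by (intro monoid.one_closed group.is_monoid group_Aut)

lemma mult_Aut:
  "\<sigma> \<in> carrier (Aut M) \<Longrightarrow> \<rho> \<in> carrier (Aut M) \<Longrightarrow> \<sigma> \<otimes>\<^bsub>Aut M\<^esub> \<rho> \<in> carrier (Aut M)"
  by (intro monoid.m_closed group.is_monoid group_Aut)

text \<open>The representative chosen for a product need not be the composite of the chosen
  representatives. The composite does belong to the product class, so by
  \<open>act_representative\<close> the two images differ by a null set.\<close>

lemma sdist_act_mult:
  assumes \<sigma>: "\<sigma> \<in> carrier (Aut M)" and \<rho>: "\<rho> \<in> carrier (Aut M)" and A: "A \<in> events"
  shows "sdist (act (\<sigma> \<otimes>\<^bsub>Aut M\<^esub> \<rho>) A) (act \<sigma> (act \<rho> A)) = 0"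
proof -
  obtain S where S: "S \<in> \<sigma>" "S \<in> mpt M" "act \<sigma> = image S" using act_rep[OF \<sigma>] .
  obtain R where R: "R \<in> \<rho>" "R \<in> mpt M" "act \<rho> = image R" using act_rep[OF \<rho>] .
  have "compose (space M) S R \<in> \<sigma> \<otimes>\<^bsub>Aut M\<^esub> \<rho>"
    using S R mult_mpt_group[OF S(2) R(2)] by (force simp: Aut_def FactGroup_def set_mult_def)
  moreover have "\<sigma> \<otimes>\<^bsub>Aut M\<^esub> \<rho> \<in> carrier (Aut M)"
    using \<sigma> \<rho> by (rule mult_Aut)
  ultimately have
    "sym_diff (act (\<sigma> \<otimes>\<^bsub>Aut M\<^esub> \<rho>) A) (compose (space M) S R ` A) \<in> null_sets M"
    using act_representative(2) A by blast
  moreover have "compose (space M) S R ` A = act \<sigma> (act \<rho> A)"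
    using sets.sets_into_space[OF A] S R by (force simp: compose_def image_iff)
  ultimately show ?thesis by (simp add: null_sets_def measure_def)
qed

lemma pow_Aut: "\<sigma> \<in> carrier (Aut M) \<Longrightarrow> \<sigma> [^]\<^bsub>Aut M\<^esub> (n :: int) \<in> carrier (Aut M)"
  using group_Aut by (rule group.int_pow_closed)

text \<open>The representative chosen for the unit need not be the identity map. Since the unit is
  idempotent, acting twice and acting once agree up to a null set, and by \<open>sdist_act\<close>
  one application cancels.\<close>

lemma sdist_act_one:
  assumes A: "A \<in> events"
  shows "sdist (act \<one>\<^bsub>Aut M\<^esub> A) A = 0"
proof -
  note one = one_Aut
  have "sdist (act \<one>\<^bsub>Aut M\<^esub> A) A = sdist (act \<one>\<^bsub>Aut M\<^esub> (act \<one>\<^bsub>Aut M\<^esub> A)) (act \<one>\<^bsub>Aut M\<^esub> A)"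
    using A one by (simp add: sdist_act act_sets)
  also have "\<dots> = sdist (act (\<one>\<^bsub>Aut M\<^esub> \<otimes>\<^bsub>Aut M\<^esub> \<one>\<^bsub>Aut M\<^esub>) A) (act \<one>\<^bsub>Aut M\<^esub> (act \<one>\<^bsub>Aut M\<^esub> A))"
    using monoid.l_one[OF group.is_monoid[OF group_Aut] one] sdist_commute by simp
  also have "\<dots> = 0" using sdist_act_mult[OF one one A] .
  finally show ?thesis .
qed

lemma sdist_act_pow_add:
  assumes "\<sigma> \<in> carrier (Aut M)" "A \<in> events"
  shows "sdist (act (\<sigma> [^]\<^bsub>Aut M\<^esub> (m + n :: int)) A)
    (act (\<sigma> [^]\<^bsub>Aut M\<^esub> m) (act (\<sigma> [^]\<^bsub>Aut M\<^esub> n) A)) = 0"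
  using sdist_act_mult[of "\<sigma> [^]\<^bsub>Aut M\<^esub> m" "\<sigma> [^]\<^bsub>Aut M\<^esub> n" A] assms
  by (simp add: group.int_pow_mult[OF group_Aut] pow_Aut)

lemma sdist_act_pow_minus:
  assumes "\<sigma> \<in> carrier (Aut M)" "A \<in> events"
  shows "sdist (act (\<sigma> [^]\<^bsub>Aut M\<^esub> (- n :: int)) (act (\<sigma> [^]\<^bsub>Aut M\<^esub> n) A)) A = 0"
proof -
  have "sdist (act (\<sigma> [^]\<^bsub>Aut M\<^esub> (- n)) (act (\<sigma> [^]\<^bsub>Aut M\<^esub> n) A)) A
    \<le> sdist (act (\<sigma> [^]\<^bsub>Aut M\<^esub> (- n)) (act (\<sigma> [^]\<^bsub>Aut M\<^esub> n) A)) (act (\<sigma> [^]\<^bsub>Aut M\<^esub> (- n + n)) A)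
      + sdist (act (\<sigma> [^]\<^bsub>Aut M\<^esub> (- n + n)) A) A"
    using assms by (intro sdist_triangle act_sets pow_Aut)
  also have "\<dots> = 0"
    using sdist_act_pow_add[OF assms, of "- n" n] sdist_act_one[OF assms(2)]
    by (simp add: sdist_commute)
  finally show ?thesis using measure_nonneg[of M] by (simp add: order_antisym)
qed

section \<open>The weak metric and convergence to the identity\<close>

lemma wdist_summable:
  "summable (\<lambda>n. (1/2) ^ Suc n * sdist (act \<sigma> (E n)) (act \<rho> (E n)))"
proof (rule summable_comparison_test')
  show "summable (\<lambda>n. (1/2) ^ Suc n :: real)" by (simp add: summable_geometric)
  show "norm ((1/2) ^ Suc n * sdist (act \<sigma> (E n)) (act \<rho> (E n))) \<le> (1/2) ^ Suc n" for n
    by (simp add: mult_left_le)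
qed

lemma sdist_le_wdist: "(1/2) ^ Suc n * sdist (act \<sigma> (E n)) (act \<rho> (E n)) \<le> wdist M E \<sigma> \<rho>"
  using sum_le_suminf[OF wdist_summable, of "{n}" \<sigma> E \<rho>] by (simp add: wdist_def)

lemma wdist_triangle:
  assumes "\<sigma> \<in> carrier (Aut M)" "\<rho> \<in> carrier (Aut M)" "\<pi> \<in> carrier (Aut M)" "range E \<subseteq> events"
  shows "wdist M E \<sigma> \<pi> \<le> wdist M E \<sigma> \<rho> + wdist M E \<rho> \<pi>"
proof -
  have "(1/2) ^ Suc n * sdist (act \<sigma> (E n)) (act \<pi> (E n))
    \<le> (1/2) ^ Suc n * sdist (act \<sigma> (E n)) (act \<rho> (E n))
      + (1/2) ^ Suc n * sdist (act \<rho> (E n)) (act \<pi> (E n))" for n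
    unfolding distrib_left[symmetric] using assms
    by (intro mult_left_mono sdist_triangle act_sets) auto
  then show ?thesis
    unfolding wdist_def suminf_add[OF wdist_summable wdist_summable]
    by (intro suminf_le wdist_summable summable_add)
qed

text \<open>As \<open>act \<sigma>\<close> preserves \<open>sdist\<close>, it cancels in every term
  of the series. Multiplying on the right by an element near the unit thus moves \<sigma> only a
  little, whatever \<sigma> is.\<close>

lemma wdist_left_invariant:
  assumes "\<sigma> \<in> carrier (Aut M)" "\<rho> \<in> carrier (Aut M)" "range E \<subseteq> events"
  shows "wdist M E (\<sigma> \<otimes>\<^bsub>Aut M\<^esub> \<rho>) \<sigma> \<le> wdist M E \<rho> \<one>\<^bsub>Aut M\<^esub>"
  unfolding wdist_def
proof (intro suminf_le wdist_summable mult_left_mono)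
  fix n
  have E: "E n \<in> events" using assms(3) by auto
  have "\<sigma> \<otimes>\<^bsub>Aut M\<^esub> \<rho> \<in> carrier (Aut M)"
    using assms(1,2) by (rule mult_Aut)
  then have "sdist (act (\<sigma> \<otimes>\<^bsub>Aut M\<^esub> \<rho>) (E n)) (act \<sigma> (E n))
    \<le> sdist (act (\<sigma> \<otimes>\<^bsub>Aut M\<^esub> \<rho>) (E n)) (act \<sigma> (act \<rho> (E n)))
      + sdist (act \<sigma> (act \<rho> (E n))) (act \<sigma> (E n))"
    using E assms by (intro sdist_triangle act_sets)
  also have "\<dots> = sdist (act \<rho> (E n)) (E n)"
    using E assms by (simp add: sdist_act_mult sdist_act act_sets)
  also have "\<dots> \<le> sdist (act \<rho> (E n)) (act \<one>\<^bsub>Aut M\<^esub> (E n)) + sdist (act \<one>\<^bsub>Aut M\<^esub> (E n)) (E n)"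
    using E assms one_Aut by (intro sdist_triangle act_sets)
  finally show "sdist (act (\<sigma> \<otimes>\<^bsub>Aut M\<^esub> \<rho>) (E n)) (act \<sigma> (E n))
      \<le> sdist (act \<rho> (E n)) (act \<one>\<^bsub>Aut M\<^esub> (E n))"
    using sdist_act_one[OF E] by simp
qed simp

text \<open>The sets on which the convergence holds form a sigma-algebra.\<close>

lemma tendsto_sdist_act:
  assumes E: "generating_family M E" and \<sigma>: "\<And>i. \<sigma> i \<in> carrier (Aut M)"
    and lim: "(\<lambda>i. wdist M E (\<sigma> i) \<one>\<^bsub>Aut M\<^esub>) \<longlonglongrightarrow> 0" and A: "A \<in> events"
  shows "(\<lambda>i. sdist (act (\<sigma> i) A) A) \<longlonglongrightarrow> 0"
proof -
  have E_sets: "range E \<subseteq> events" using E by (simp add: generating_family_def)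
  have gen_sub: "B \<in> events" if "B \<in> sigma_sets (space M) (range E)" for B
    using that E_sets sets.sigma_sets_subset by blast
  have gen: "(\<lambda>i. sdist (act (\<sigma> i) B) B) \<longlonglongrightarrow> 0" if "B \<in> sigma_sets (space M) (range E)" for B
    using that
  proof induction
    case (Basic B)
    then obtain n where n: "B = E n" by auto
    have B: "B \<in> events" using n E_sets by auto
    \<comment> \<open>The factor undoes the weight of E n in \<open>wdist\<close>, so a single
      generator is displaced by at most a fixed multiple of the weak distance.\<close>
    have le: "sdist (act (\<sigma> i) B) B \<le> 2 ^ Suc n * wdist M E (\<sigma> i) \<one>\<^bsub>Aut M\<^esub>" for i
    proof -
      have "sdist (act (\<sigma> i) B) B
        \<le> sdist (act (\<sigma> i) B) (act \<one>\<^bsub>Aut M\<^esub> B) + sdist (act \<one>\<^bsub>Aut M\<^esub> B) B"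
        using B \<sigma> one_Aut by (intro sdist_triangle act_sets)
      also have "\<dots> = 2 ^ Suc n * ((1/2) ^ Suc n * sdist (act (\<sigma> i) B) (act \<one>\<^bsub>Aut M\<^esub> B))"
        using sdist_act_one[OF B] by (simp add: power_one_over)
      also have "\<dots> \<le> 2 ^ Suc n * wdist M E (\<sigma> i) \<one>\<^bsub>Aut M\<^esub>"
        unfolding n by (intro mult_left_mono sdist_le_wdist) auto
      finally show ?thesis .
    qed
    show ?case
      by (rule Lim_null_comparison[OF always_eventually
            tendsto_mult_right_zero[OF lim, of "2 ^ Suc n"]]) (use le in \<open>simp del: power_Suc\<close>)
  next
    case Empty
    show ?case by (simp add: act_def)
  next
    case (Compl B)
    have B: "B \<in> events" using Compl gen_sub by auto
    \<comment> \<open>A bijection maps the complement of B to the complement of the image of B, and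
      complementing both sets does not change their symmetric difference.\<close>
    have "sym_diff (act (\<sigma> i) (space M - B)) (space M - B) = sym_diff (act (\<sigma> i) B) B" for i
      using B \<sigma> act_sets[OF \<sigma> B, THEN sets.sets_into_space] sets.sets_into_space[OF B]
      by (auto simp: act_Diff act_space)
    then show ?case using Compl.IH by simp
  next
    case (Union B)
    have B: "B n \<in> events" for n using Union gen_sub by auto
    \<comment> \<open>Convergence on the countable union is reached through the finite unions ?V m:
      these exhaust ?U in measure, and on each of them the displacement is at most a finite sum of
      null sequences.\<close>
    let ?U = "\<Union>n. B n" and ?V = "\<lambda>m. \<Union>n<m. B n"
    have U: "?U \<in> events" and V: "?V m \<in> events" for m using B by auto
    have V_lim: "(\<lambda>m. sdist (?V m) ?U) \<longlonglongrightarrow> 0"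
    proof -
      have "(\<lambda>m. prob (?V m)) \<longlonglongrightarrow> prob (\<Union>m. ?V m)"
        using V by (intro finite_Lim_measure_incseq incseq_SucI UN_mono) auto
      moreover have "(\<Union>m. ?V m) = ?U" by auto
      ultimately have "(\<lambda>m. prob ?U - prob (?V m)) \<longlonglongrightarrow> 0"
        using LIM_zero[of "\<lambda>m. prob (?V m)" "prob ?U"] tendsto_minus by fastforce
      moreover have "sdist (?V m) ?U = prob ?U - prob (?V m)" for m
      proof -
        have "sym_diff (?V m) ?U = ?U - ?V m" by auto
        moreover have "prob (?U - ?V m) = prob ?U - prob (?V m)"
          using finite_measure_Diff[OF U V, of m] by auto
        ultimately show ?thesis by (simp only:)
      qed
      ultimately show ?thesis by simp
    qed
    have V_act: "(\<lambda>i. sdist (act (\<sigma> i) (?V m)) (?V m)) \<longlonglongrightarrow> 0" for m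
    proof (rule tendsto_sandwich[OF _ _ tendsto_const])
      have "sdist (act (\<sigma> i) (?V m)) (?V m) \<le> (\<Sum>n<m. sdist (act (\<sigma> i) (B n)) (B n))" for i
      proof -
        have "sdist (act (\<sigma> i) (?V m)) (?V m) \<le> prob (\<Union>n<m. sym_diff (act (\<sigma> i) (B n)) (B n))"
          using B \<sigma> V act_sets by (intro finite_measure_mono sets.finite_UN) (auto simp: act_UN)
        also have "\<dots> \<le> (\<Sum>n<m. sdist (act (\<sigma> i) (B n)) (B n))"
          using B \<sigma> act_sets by (intro finite_measure_subadditive_finite) auto
        finally show ?thesis .
      qed
      then show "\<forall>\<^sub>F i in sequentially. sdist (act (\<sigma> i) (?V m)) (?V m)
        \<le> (\<Sum>n<m. sdist (act (\<sigma> i) (B n)) (B n))" by simp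
      show "(\<lambda>i. \<Sum>n<m. sdist (act (\<sigma> i) (B n)) (B n)) \<longlonglongrightarrow> 0"
        using Union.IH by (intro tendsto_null_sum) auto
    qed simp
    show ?case
    proof (rule LIMSEQ_I)
      fix r :: real assume r: "0 < r"
      \<comment> \<open>Of the three errors, two equal \<open>sdist (?V m) ?U\<close>, because
        \<sigma> i preserves \<open>sdist\<close>. This makes one m work for all i at once; only the
        displacement of ?V m depends on i.\<close>
      obtain m where m: "sdist (?V m) ?U < r / 3"
        using order_tendstoD(2)[OF V_lim, of "r / 3"] r by (auto simp: eventually_sequentially)
      obtain N where N: "\<And>i. i \<ge> N \<Longrightarrow> sdist (act (\<sigma> i) (?V m)) (?V m) < r / 3"
        using order_tendstoD(2)[OF V_act[of m], of "r / 3"] r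
        by (auto simp: eventually_sequentially)
      have "sdist (act (\<sigma> i) ?U) ?U < r" if "i \<ge> N" for i
      proof -
        have "sdist (act (\<sigma> i) ?U) ?U
          \<le> sdist (act (\<sigma> i) ?U) (act (\<sigma> i) (?V m)) + sdist (act (\<sigma> i) (?V m)) ?U"
          using U V \<sigma> by (intro sdist_triangle act_sets)
        moreover have "sdist (act (\<sigma> i) (?V m)) ?U
          \<le> sdist (act (\<sigma> i) (?V m)) (?V m) + sdist (?V m) ?U"
          using U V \<sigma> by (intro sdist_triangle act_sets)
        moreover have "sdist (act (\<sigma> i) ?U) (act (\<sigma> i) (?V m)) = sdist (?V m) ?U"
          unfolding sdist_act[OF \<sigma> U V] by (rule sdist_commute)
        ultimately show ?thesis using m N[OF that] by linarith
      qed
      then show "\<exists>N. \<forall>i\<ge>N. norm (sdist (act (\<sigma> i) ?U) ?U - 0) < r" by auto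
    qed
  qed
  \<comment> \<open>The family generates only up to null sets, so A itself need not lie in the
    generated sigma-algebra; it is replaced by some B at distance 0.\<close>
  obtain B where B: "B \<in> sigma_sets (space M) (range E)" and AB: "sym_diff A B \<in> null_sets M"
    using E A by (auto simp: generating_family_def)
  have AB0: "sdist A B = 0" using AB by (simp add: null_sets_def measure_def)
  have "sdist (act (\<sigma> i) A) A \<le> sdist (act (\<sigma> i) B) B" for i
  proof -
    have "sdist (act (\<sigma> i) A) A \<le> sdist (act (\<sigma> i) A) (act (\<sigma> i) B) + sdist (act (\<sigma> i) B) A"
      using A gen_sub[OF B] \<sigma> by (intro sdist_triangle act_sets)
    moreover have "sdist (act (\<sigma> i) B) A \<le> sdist (act (\<sigma> i) B) B + sdist B A"
      using A gen_sub[OF B] \<sigma> by (intro sdist_triangle act_sets)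
    ultimately show ?thesis
      using AB0 sdist_act[OF \<sigma> A gen_sub[OF B], of i] sdist_commute[of A B] by simp
  qed
  then show ?thesis by (intro Lim_null_comparison[OF always_eventually gen[OF B]]) simp
qed

section \<open>Hitting times of prescribed sign for ergodic automorphisms\<close>

lemma ergodic_hits_pos:
  assumes \<tau>: "\<tau> \<in> carrier (Aut M)" and erg: "ergodic M \<tau>"
    and A: "A \<in> events" "prob A > 0" and B: "B \<in> events" "prob B > 0"
  obtains l :: int where "l > 0" "prob (act (\<tau> [^]\<^bsub>Aut M\<^esub> l) A \<inter> B) > 0"
proof -
  \<comment> \<open>The forward orbit starts at exponent 1, so that any n found later yields a
    positive time. Its union ?U is mapped into itself and has at least the measure of A, so
    ergodicity makes it of full measure.\<close>
  let ?A = "\<lambda>n :: nat. act (\<tau> [^]\<^bsub>Aut M\<^esub> int (Suc n)) A"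
  let ?U = "\<Union>n. ?A n"
  have An: "?A n \<in> events" for n using A \<tau> by (intro act_sets pow_Aut)
  then have U: "?U \<in> events" by auto
  have step: "sdist (?A (Suc n)) (act \<tau> (?A n)) = 0" for n
    using sdist_act_pow_add[OF \<tau> A(1), of 1 "int (Suc n)"] group.int_pow_1[OF group_Aut \<tau>]
    by simp
  have "prob (act \<tau> ?U - ?U) = 0"
  proof -
    \<comment> \<open>The image of ?A n is ?A (Suc n) only up to a null set, hence forward
      invariance of ?U also holds only up to a countable union of null sets.\<close>
    have "act \<tau> (?A n) - ?U \<in> null_sets M" for n
    proof (rule null_sets_subset)
      show "sym_diff (?A (Suc n)) (act \<tau> (?A n)) \<in> null_sets M"
        using step An \<tau> act_sets by (subst null_sets_iff_prob) (blast, blast)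
      show "act \<tau> (?A n) - ?U \<in> events" by (rule sets.Diff[OF act_sets[OF \<tau> An] U])
      have "?A (Suc n) \<subseteq> ?U" by blast
      then show "act \<tau> (?A n) - ?U \<subseteq> sym_diff (?A (Suc n)) (act \<tau> (?A n))" by blast
    qed
    then have "(\<Union>n. act \<tau> (?A n) - ?U) \<in> null_sets M" by (intro null_sets_UN) auto
    moreover have "act \<tau> ?U - ?U = (\<Union>n. act \<tau> (?A n) - ?U)" by (auto simp: act_UN)
    ultimately show ?thesis by (simp add: null_sets_def measure_def)
  qed
  then have "sdist (act \<tau> ?U) ?U = 0"
    using U \<tau> by (intro sdist_zero_of_subset) (auto simp: act_sets prob_act)
  then have "prob ?U = 0 \<or> prob ?U = 1"
    using erg U \<tau> unfolding ergodic_def by (metis act_sets null_sets_iff_prob sets.Diff sets.Un)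
  moreover have "prob A \<le> prob ?U"
  proof (rule order_trans)
    show "prob A \<le> prob (?A 0)" using prob_act[OF pow_Aut[OF \<tau>] A(1)] by simp
    show "prob (?A 0) \<le> prob ?U" by (rule finite_measure_mono[OF UN_upper U]) simp
  qed
  ultimately have U1: "prob ?U = 1" using A by linarith
  have "\<exists>n. prob (?A n \<inter> B) > 0"
  proof (rule ccontr)
    assume "\<not> ?thesis"
    then have "prob (?A n \<inter> B) = 0" for n
      using measure_nonneg[of M "?A n \<inter> B"] by (metis order_neq_le_trans)
    then have "?A n \<inter> B \<in> null_sets M" for n using An B by (subst null_sets_iff_prob) auto
    then have "(\<Union>n. ?A n \<inter> B) \<in> null_sets M" by (intro null_sets_UN) auto
    moreover have "?U \<inter> B = (\<Union>n. ?A n \<inter> B)" by auto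
    ultimately have "prob (?U \<inter> B) = 0" by (simp add: null_sets_def measure_def)
    \<comment> \<open>B is split by ?U: its part inside ?U is null by the assumption, its part
      outside because ?U has full measure.\<close>
    moreover have "prob (B - ?U) \<le> prob (space M - ?U)"
      using U sets.sets_into_space[OF B(1)] by (intro finite_measure_mono Diff_mono sets.Diff) auto
    ultimately show False
      using finite_measure_Diff'[OF B(1) U] prob_compl[OF U] U1 B(2)
      by (simp add: Int_commute del: of_nat_Suc)
  qed
  then obtain n where "prob (?A n \<inter> B) > 0" ..
  then show ?thesis by (intro that[of "int (Suc n)"]) auto
qed

text \<open>The roles of A and B are exchanged: a positive power l takes B onto a non-null part of
  A, and applying the inverse power to this intersection gives a negative time taking A to
  B.\<close>

lemma ergodic_hits_neg:
  assumes \<tau>: "\<tau> \<in> carrier (Aut M)" and erg: "ergodic M \<tau>"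
    and A: "A \<in> events" "prob A > 0" and B: "B \<in> events" "prob B > 0"
  obtains l :: int where "l < 0" "prob (act (\<tau> [^]\<^bsub>Aut M\<^esub> l) A \<inter> B) > 0"
proof -
  obtain l :: int where l: "l > 0" "prob (act (\<tau> [^]\<^bsub>Aut M\<^esub> l) B \<inter> A) > 0"
    using ergodic_hits_pos[OF \<tau> erg B A] .
  let ?S = "act (\<tau> [^]\<^bsub>Aut M\<^esub> l)" and ?R = "act (\<tau> [^]\<^bsub>Aut M\<^esub> (- l))"
  have "prob (?S B \<inter> A) = prob (?R (?S B) \<inter> ?R A)"
    using A B \<tau> prob_act[OF pow_Aut[OF \<tau>, of "- l"], of "?S B \<inter> A"] act_sets[OF pow_Aut[OF \<tau>, of l] B(1)]
    by (simp add: act_Int act_sets pow_Aut)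
  also have "\<dots> \<le> prob (B \<inter> ?R A) + sdist (?R (?S B)) B"
    using A B \<tau> by (intro prob_Int_le_sdist act_sets pow_Aut)
  also have "\<dots> = prob (?R A \<inter> B)"
    using sdist_act_pow_minus[OF \<tau> B(1)] by (simp add: Int_commute)
  finally show ?thesis using l by (intro that[of "- l"]) auto
qed

section \<open>Ergodicity of whirly automorphisms\<close>

lemma sdist_act_pow_invariant:
  assumes \<tau>: "\<tau> \<in> carrier (Aut M)" and A: "A \<in> events" and inv: "sdist (act \<tau> A) A = 0"
  shows "sdist (act (\<tau> [^]\<^bsub>Aut M\<^esub> (n :: int)) A) A = 0"
proof -
  have nat: "sdist (act (\<tau> [^]\<^bsub>Aut M\<^esub> int n) A) A = 0" for n
  proof (induction n)
    case 0
    show ?case using sdist_act_one[OF A] by simp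
  next
    case (Suc n)
    let ?T = "act (\<tau> [^]\<^bsub>Aut M\<^esub> int n)"
    have 1: "\<tau> [^]\<^bsub>Aut M\<^esub> (1 :: int) = \<tau>" using group.int_pow_1[OF group_Aut \<tau>] .
    have "sdist (act (\<tau> [^]\<^bsub>Aut M\<^esub> int (Suc n)) A) A
      \<le> sdist (act (\<tau> [^]\<^bsub>Aut M\<^esub> int (Suc n)) A) (?T (act \<tau> A)) + sdist (?T (act \<tau> A)) A"
      using A \<tau> by (intro sdist_triangle act_sets pow_Aut)
    also have "\<dots> = sdist (?T (act \<tau> A)) A"
      using sdist_act_pow_add[OF \<tau> A, of "int n" 1] 1 by (simp add: add.commute)
    also have "\<dots> \<le> sdist (?T (act \<tau> A)) (?T A) + sdist (?T A) A"
      using A \<tau> by (intro sdist_triangle act_sets pow_Aut)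
    also have "\<dots> = 0" using Suc inv A \<tau> by (simp add: sdist_act act_sets pow_Aut)
    finally show ?case using measure_nonneg[of M] by (simp add: order_antisym)
  qed
  show ?thesis
  proof (cases "n \<ge> 0")
    case True
    then show ?thesis using nat[of "nat n"] by simp
  next
    case False
    then have m: "sdist (act (\<tau> [^]\<^bsub>Aut M\<^esub> (- n)) A) A = 0" using nat[of "nat (- n)"] by simp
    \<comment> \<open>For negative n the power - n is already known to fix A up to a null set. As ?T
      preserves \<open>sdist\<close>, A may be replaced by ?S A under ?T, where the two powers
      cancel.\<close>
    let ?T = "act (\<tau> [^]\<^bsub>Aut M\<^esub> n)" and ?S = "act (\<tau> [^]\<^bsub>Aut M\<^esub> (- n))"
    have "sdist (?T A) A \<le> sdist (?T A) (?T (?S A)) + sdist (?T (?S A)) A"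
      using A \<tau> by (intro sdist_triangle act_sets pow_Aut)
    also have "\<dots> = 0"
      using m sdist_act_pow_minus[OF \<tau> A, of "- n"] A \<tau> sdist_commute[of A "?S A"]
      by (simp add: sdist_act act_sets pow_Aut)
    finally show ?thesis using measure_nonneg[of M] by (simp add: order_antisym)
  qed
qed

lemma whirly_ergodic:
  assumes \<tau>: "\<tau> \<in> carrier (Aut M)" and w: "whirly M E \<tau>"
  shows "ergodic M \<tau>"
  unfolding ergodic_def
proof (intro ballI impI, rule ccontr)
  fix A assume A: "A \<in> events" and inv: "sym_diff (act \<tau> A) A \<in> null_sets M"
    and "\<not> (prob A = 0 \<or> prob A = 1)"
  moreover have "prob (space M - A) = 1 - prob A" using prob_compl[OF A] .
  ultimately have pos: "prob A > 0" "prob (space M - A) > 0"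
    using measure_nonneg[of M A] prob_le_1[of A] by linarith+
  \<comment> \<open>The radius 1 is an arbitrary positive choice; the set B will be the complement
    of A.\<close>
  have "\<forall>B\<in>events. prob A > 0 \<longrightarrow> prob B > 0 \<longrightarrow>
      (\<exists>n :: int. \<tau> [^]\<^bsub>Aut M\<^esub> n \<in> id_nhd M E 1 \<and> prob (act (\<tau> [^]\<^bsub>Aut M\<^esub> n) A \<inter> B) > 0)"
    using w A zero_less_one unfolding whirly_def by blast
  then obtain n :: int where n: "prob (act (\<tau> [^]\<^bsub>Aut M\<^esub> n) A \<inter> (space M - A)) > 0"
    using pos A by blast
  have "sdist (act \<tau> A) A = 0" using inv by (simp add: null_sets_def measure_def)
  then have "sdist (act (\<tau> [^]\<^bsub>Aut M\<^esub> n) A) A = 0" by (rule sdist_act_pow_invariant[OF \<tau> A])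
  then have "prob (act (\<tau> [^]\<^bsub>Aut M\<^esub> n) A \<inter> (space M - A)) \<le> prob (A \<inter> (space M - A))"
    using prob_Int_le_sdist[of "act (\<tau> [^]\<^bsub>Aut M\<^esub> n) A" A "space M - A"] A \<tau>
    by (auto simp: act_sets pow_Aut)
  moreover have "A \<inter> (space M - A) = {}" by auto
  ultimately show False using n by simp
qed

section \<open>The two implications between the whirly and the alternative condition\<close>

lemma whirly_positive_time:
  assumes E: "generating_family M E" and \<tau>: "\<tau> \<in> carrier (Aut M)" and w: "whirly M E \<tau>"
    and \<epsilon>: "\<epsilon> > 0" and A: "A \<in> events" "prob A > 0" and B: "B \<in> events" "prob B > 0"
  shows "\<exists>n :: int. n > 0 \<and> \<tau> [^]\<^bsub>Aut M\<^esub> n \<in> id_nhd M E \<epsilon> \<and>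
    prob (act (\<tau> [^]\<^bsub>Aut M\<^esub> n) A \<inter> B) > 0"
proof -
  obtain m :: int where m: "\<tau> [^]\<^bsub>Aut M\<^esub> m \<in> id_nhd M E \<epsilon>"
      "prob (act (\<tau> [^]\<^bsub>Aut M\<^esub> m) A \<inter> B) > 0"
    using w \<epsilon> A B unfolding whirly_def by blast
  obtain k :: "nat \<Rightarrow> nat" where k: "filterlim k at_top sequentially"
      and "(\<lambda>i. wdist M E (\<tau> [^]\<^bsub>Aut M\<^esub> k i) \<one>\<^bsub>Aut M\<^esub>) \<longlonglongrightarrow> 0"
    using w unfolding whirly_def rigid_def by blast
  then have lim: "(\<lambda>i. wdist M E (\<tau> [^]\<^bsub>Aut M\<^esub> int (k i)) \<one>\<^bsub>Aut M\<^esub>) \<longlonglongrightarrow> 0"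
    by (simp add: int_pow_int)
  have E_sets: "range E \<subseteq> events" using E by (simp add: generating_family_def)
  let ?\<sigma> = "\<tau> [^]\<^bsub>Aut M\<^esub> m" and ?\<rho> = "\<lambda>i. \<tau> [^]\<^bsub>Aut M\<^esub> int (k i)"
  have \<sigma>: "?\<sigma> \<in> carrier (Aut M)" and \<rho>: "?\<rho> i \<in> carrier (Aut M)" for i
    using \<tau> by (auto intro: pow_Aut)
  have "wdist M E ?\<sigma> \<one>\<^bsub>Aut M\<^esub> < \<epsilon>" using m by (simp add: id_nhd_def)
  \<comment> \<open>The bound is the room that m leaves inside the open ball of radius \<epsilon>;
    left invariance and the triangle inequality will use it up.\<close>
  then have "\<forall>\<^sub>F i in sequentially. wdist M E (?\<rho> i) \<one>\<^bsub>Aut M\<^esub> < \<epsilon> - wdist M E ?\<sigma> \<one>\<^bsub>Aut M\<^esub>"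
    using lim by (intro order_tendstoD(2)) auto
  \<comment> \<open>Rigidity controls the weak metric; here it is transferred to the given set A,
    with the measure of the intersection to be preserved as tolerance.\<close>
  moreover have "\<forall>\<^sub>F i in sequentially. sdist (act (?\<rho> i) A) A < prob (act ?\<sigma> A \<inter> B)"
    using tendsto_sdist_act[OF E \<rho> lim A(1)] m by (intro order_tendstoD(2)) auto
  \<comment> \<open>The threshold forces m + k i to be at least 1, also for negative m.\<close>
  moreover have "\<forall>\<^sub>F i in sequentially. nat (- m) + 1 \<le> k i"
    using k by (simp add: filterlim_at_top)
  ultimately have "\<forall>\<^sub>F i in sequentially. wdist M E (?\<rho> i) \<one>\<^bsub>Aut M\<^esub> < \<epsilon> - wdist M E ?\<sigma> \<one>\<^bsub>Aut M\<^esub>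
      \<and> sdist (act (?\<rho> i) A) A < prob (act ?\<sigma> A \<inter> B) \<and> nat (- m) + 1 \<le> k i"
    by eventually_elim auto
  then obtain i where i: "wdist M E (?\<rho> i) \<one>\<^bsub>Aut M\<^esub> < \<epsilon> - wdist M E ?\<sigma> \<one>\<^bsub>Aut M\<^esub>"
      "sdist (act (?\<rho> i) A) A < prob (act ?\<sigma> A \<inter> B)" "nat (- m) + 1 \<le> k i"
    by (auto simp: eventually_sequentially)
  let ?n = "m + int (k i)"
  have n: "\<tau> [^]\<^bsub>Aut M\<^esub> ?n = ?\<sigma> \<otimes>\<^bsub>Aut M\<^esub> ?\<rho> i"
    using \<tau> by (simp add: group.int_pow_mult[OF group_Aut])
  have n_Aut: "\<tau> [^]\<^bsub>Aut M\<^esub> ?n \<in> carrier (Aut M)" using \<tau> by (rule pow_Aut)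
  have "wdist M E (\<tau> [^]\<^bsub>Aut M\<^esub> ?n) \<one>\<^bsub>Aut M\<^esub>
      \<le> wdist M E (\<tau> [^]\<^bsub>Aut M\<^esub> ?n) ?\<sigma> + wdist M E ?\<sigma> \<one>\<^bsub>Aut M\<^esub>"
    using n_Aut \<sigma> one_Aut E_sets by (rule wdist_triangle)
  also have "\<dots> \<le> wdist M E (?\<rho> i) \<one>\<^bsub>Aut M\<^esub> + wdist M E ?\<sigma> \<one>\<^bsub>Aut M\<^esub>"
    unfolding n using wdist_left_invariant[OF \<sigma> \<rho> E_sets] by simp
  finally have "\<tau> [^]\<^bsub>Aut M\<^esub> ?n \<in> id_nhd M E \<epsilon>"
    using i(1) n_Aut by (simp add: id_nhd_def)
  moreover have "prob (act (\<tau> [^]\<^bsub>Aut M\<^esub> ?n) A \<inter> B) > 0"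
  proof -
    \<comment> \<open>The product is split with ?\<rho> i acting first, so that ?\<sigma> cancels
      and the displacement is that of A under ?\<rho> i alone.\<close>
    have "sdist (act ?\<sigma> A) (act (\<tau> [^]\<^bsub>Aut M\<^esub> ?n) A)
      \<le> sdist (act ?\<sigma> A) (act ?\<sigma> (act (?\<rho> i) A))
        + sdist (act ?\<sigma> (act (?\<rho> i) A)) (act (\<tau> [^]\<^bsub>Aut M\<^esub> ?n) A)"
      using A n_Aut \<sigma> \<rho> by (intro sdist_triangle act_sets)
    also have "\<dots> = sdist (act (?\<rho> i) A) A"
      using trans[OF sdist_commute sdist_act[OF \<sigma> act_sets[OF \<rho> A(1)] A(1)], of i]
        trans[OF sdist_commute sdist_act_pow_add[OF \<tau> A(1)], of m "int (k i)"] by simp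
    finally show ?thesis
      using prob_Int_le_sdist[OF act_sets[OF \<sigma> A(1)] act_sets[OF n_Aut A(1)] B(1)] i(2) by linarith
  qed
  moreover have "?n > 0" using i(3) by linarith
  ultimately show ?thesis by blast
qed

text \<open>For every integer l the image of A under the power l has the same positive measure as A
  and can be taken as the target in \<open>whirly_positive_time\<close>. The sign of l does not
  enter, hence L is arbitrary.\<close>

lemma whirly_imp_alt_whirly:
  assumes E: "generating_family M E" and \<tau>: "\<tau> \<in> carrier (Aut M)" and w: "whirly M E \<tau>"
  shows "alt_whirly L M E \<tau>"
  unfolding alt_whirly_def
proof (intro conjI allI ballI impI)
  show "rigid M E \<tau>" using w by (simp add: whirly_def)
  show "ergodic M \<tau>" using \<tau> w by (rule whirly_ergodic)
  show "\<exists>n :: int. n > 0 \<and> \<tau> [^]\<^bsub>Aut M\<^esub> n \<in> id_nhd M E \<epsilon> \<and>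
      prob (act (\<tau> [^]\<^bsub>Aut M\<^esub> n) A \<inter> act (\<tau> [^]\<^bsub>Aut M\<^esub> l) A) > 0"
    if "\<epsilon> > 0" "A \<in> events" "prob A > 0" for \<epsilon> A and l :: int
    using whirly_positive_time[OF E \<tau> w that act_sets[OF pow_Aut[OF \<tau>] that(2)], of l]
      prob_act[OF pow_Aut[OF \<tau>] that(2)] that(3) by simp
qed

text \<open>The sign of l enters only through \<open>hits\<close>, which is supplied by
  \<open>ergodic_hits_pos\<close> or \<open>ergodic_hits_neg\<close>; the two versions of the
  condition thus share one proof.\<close>

lemma alt_whirly_imp_whirly:
  assumes \<tau>: "\<tau> \<in> carrier (Aut M)" and w: "alt_whirly L M E \<tau>"
    and hits: "\<And>A B. A \<in> events \<Longrightarrow> prob A > 0 \<Longrightarrow> B \<in> events \<Longrightarrow> prob B > 0 \<Longrightarrow>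
      \<exists>l\<in>L. prob (act (\<tau> [^]\<^bsub>Aut M\<^esub> l) A \<inter> B) > 0"
  shows "whirly M E \<tau>"
  unfolding whirly_def
proof (intro conjI allI ballI impI)
  show "rigid M E \<tau>" using w by (simp add: alt_whirly_def)
  fix \<epsilon> :: real and A B
  assume \<epsilon>: "\<epsilon> > 0" and A: "A \<in> events" "prob A > 0" and B: "B \<in> events" "prob B > 0"
  obtain l where l: "l \<in> L" "prob (act (\<tau> [^]\<^bsub>Aut M\<^esub> l) A \<inter> B) > 0" using hits[OF A B] by blast
  let ?T = "act (\<tau> [^]\<^bsub>Aut M\<^esub> l)" and ?S = "act (\<tau> [^]\<^bsub>Aut M\<^esub> (- l))"
  have TS: "sdist (?T (?S B)) B = 0" using sdist_act_pow_minus[OF \<tau> B(1), of "- l"] by simp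
  \<comment> \<open>?C is the part of A that the power l moves into B. A return of ?C to its own
    image under that power then also takes A to B, because ?C lies in A and ?T ?C lies in B up to a
    null set.\<close>
  let ?C = "A \<inter> ?S B"
  have SB: "?S B \<in> events" using B \<tau> by (intro act_sets pow_Aut)
  have C: "?C \<in> events" using A SB by simp
  \<comment> \<open>?T ?C equals ?T A intersected with ?T (?S B), which is B up to a null set, so ?C
    inherits positive measure from the hit.\<close>
  have "prob (?T A \<inter> B) \<le> prob (?T A \<inter> ?T (?S B)) + sdist B (?T (?S B))"
    using prob_Int_le_sdist[of B "?T (?S B)" "?T A"] A B SB \<tau>
    by (simp add: act_sets pow_Aut Int_commute)
  also have "\<dots> = prob ?C"
    using prob_act[OF pow_Aut[OF \<tau>] C, of l] TS A SB \<tau> sdist_commute[of B]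
    by (simp add: act_Int pow_Aut)
  finally have "prob ?C > 0" using l by simp
  then obtain n :: int where n: "\<tau> [^]\<^bsub>Aut M\<^esub> n \<in> id_nhd M E \<epsilon>"
      "prob (act (\<tau> [^]\<^bsub>Aut M\<^esub> n) ?C \<inter> ?T ?C) > 0"
    using w \<epsilon> l(1) C unfolding alt_whirly_def by blast
  have nA: "act (\<tau> [^]\<^bsub>Aut M\<^esub> n) A \<in> events" using A \<tau> by (intro act_sets pow_Aut)
  have TSB: "?T (?S B) \<in> events" by (rule act_sets[OF pow_Aut[OF \<tau>] SB])
  have "prob (act (\<tau> [^]\<^bsub>Aut M\<^esub> n) ?C \<inter> ?T ?C) \<le> prob (?T (?S B) \<inter> act (\<tau> [^]\<^bsub>Aut M\<^esub> n) A)"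
    using act_mono[of ?C A "\<tau> [^]\<^bsub>Aut M\<^esub> n"] act_mono[of ?C "?S B" "\<tau> [^]\<^bsub>Aut M\<^esub> l"]
    by (intro finite_measure_mono sets.Int TSB nA) blast
  also have "\<dots> \<le> prob (B \<inter> act (\<tau> [^]\<^bsub>Aut M\<^esub> n) A) + sdist (?T (?S B)) B"
    using TSB B(1) nA by (rule prob_Int_le_sdist)
  also have "\<dots> = prob (act (\<tau> [^]\<^bsub>Aut M\<^esub> n) A \<inter> B)" using TS by (simp add: Int_commute)
  finally show "\<exists>n :: int. \<tau> [^]\<^bsub>Aut M\<^esub> n \<in> id_nhd M E \<epsilon> \<and>
      prob (act (\<tau> [^]\<^bsub>Aut M\<^esub> n) A \<inter> B) > 0" using n by fastforce
qed

end

theorem theorem3p2: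
  fixes M :: "'a measure" and E :: "nat \<Rightarrow> 'a set" and \<tau> :: "('a \<Rightarrow> 'a) set"
  assumes "standard_lebesgue_space M"
    and "generating_family M E"
    and "\<tau> \<in> carrier (Aut M)"
  shows "(whirly M E \<tau> \<longleftrightarrow> alt_whirly {l. l > 0} M E \<tau>) \<and>
         (whirly M E \<tau> \<longleftrightarrow> alt_whirly {l. l < 0} M E \<tau>)"
proof -
  interpret prob_space M using assms(1) by (simp add: standard_lebesgue_space_def)
  have "whirly M E \<tau>" if w: "alt_whirly {l. l > 0} M E \<tau>"
  proof (rule alt_whirly_imp_whirly[OF assms(3) w])
    have erg: "ergodic M \<tau>" using w by (simp add: alt_whirly_def)
    fix A B
    assume "A \<in> events" "prob A > 0" "B \<in> events" "prob B > 0"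
    from ergodic_hits_pos[OF assms(3) erg this]
    obtain l :: int where "l > 0" "prob (act (\<tau> [^]\<^bsub>Aut M\<^esub> l) A \<inter> B) > 0" .
    then show "\<exists>l\<in>{l :: int. l > 0}. prob (act (\<tau> [^]\<^bsub>Aut M\<^esub> l) A \<inter> B) > 0" by auto
  qed
  moreover have "whirly M E \<tau>" if w: "alt_whirly {l. l < 0} M E \<tau>"
  proof (rule alt_whirly_imp_whirly[OF assms(3) w])
    have erg: "ergodic M \<tau>" using w by (simp add: alt_whirly_def)
    fix A B
    assume "A \<in> events" "prob A > 0" "B \<in> events" "prob B > 0"
    from ergodic_hits_neg[OF assms(3) erg this]
    obtain l :: int where "l < 0" "prob (act (\<tau> [^]\<^bsub>Aut M\<^esub> l) A \<inter> B) > 0" .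
    then show "\<exists>l\<in>{l :: int. l < 0}. prob (act (\<tau> [^]\<^bsub>Aut M\<^esub> l) A \<inter> B) > 0" by auto
  qed
  moreover have "alt_whirly L M E \<tau>" if "whirly M E \<tau>" for L
    using whirly_imp_alt_whirly[OF assms(2,3) that] .
  ultimately show ?thesis by blast
qed

end
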